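(* Let $\mathcal{X}\subset\mathbb{R}^n$ be compact and convex, and let $f$ be convex and $\beta$-smooth on $\mathcal{X}$, $\beta>0$. Let $x^*\in\mathrm{argmin}_{x\in\mathcal{X}}f(x)$, $x_1\in\mathcal{X}$, and let projected gradient descent with $\eta=\frac1\beta$ be defined by $x_{s+1}=\Pi_{\mathcal{X}}(x_s-\eta\nabla f(x_s))$, $s\ge 1$. Then for every $t\ge 1$, $$f(x_t)-f(x^* )\le\frac{3\beta\|x_1-x^*\|^2+f(x_1)-f(x^* )}{t}.$$
   Context: $\|\cdot\|$ is the Euclidean norm and $\Pi_{\mathcal{X}}(x)=\mathrm{argmin}_{y\in\mathcal{X}}\|x-y\|$. A continuously differentiable function $f$ is $\beta$-smooth on $\mathcal{X}$ if $\|\nabla f(x)-\nabla f(y)\|\le\beta\|x-y\|$ for all $x,y\in\mathcal{X}$. *)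

theory Defs
  imports "HOL-Analysis.Analysis"
begin

text \<open>
  The vector field \<open>G\<close> is a continuous gradient of \<open>f\<close> on \<open>X\<close>.  The derivative is taken within \<open>X\<close>,
  so \<open>f\<close> need only be meaningful on \<open>X\<close>.  If \<open>f\<close> is differentiable in a neighbourhood of \<open>X\<close>,
  its ordinary gradient qualifies.  When \<open>X\<close> is convex with nonempty interior, \<open>G\<close> is uniquely
  determined on \<open>X\<close>.
\<close>
definition gradient_on :: "(real ^ 'n) set \<Rightarrow> (real ^ 'n \<Rightarrow> real) \<Rightarrow> (real ^ 'n \<Rightarrow> real ^ 'n) \<Rightarrow> bool"
  where "gradient_on X f G \<longleftrightarrow>
    (\<forall>x\<in>X. (f has_derivative (\<lambda>h. G x \<bullet> h)) (at x within X)) \<and> continuous_on X G"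

definition smooth_on :: "real \<Rightarrow> (real ^ 'n) set \<Rightarrow> (real ^ 'n \<Rightarrow> real) \<Rightarrow> (real ^ 'n \<Rightarrow> real ^ 'n) \<Rightarrow> bool"
  where "smooth_on \<beta> X f G \<longleftrightarrow>
    gradient_on X f G \<and> (\<forall>x\<in>X. \<forall>y\<in>X. norm (G x - G y) \<le> \<beta> * norm (x - y))"

text \<open>
  Iterates are indexed from 1; the value \<open>x 0\<close> is irrelevant.  The projection onto \<open>X\<close> is
  \<^const>\<open>closest_point\<close>, which is the unique minimiser of the Euclidean distance when \<open>X\<close> is
  nonempty, closed and convex.
\<close>
definition projected_gradient_descent ::
    "(real ^ 'n) set \<Rightarrow> (real ^ 'n \<Rightarrow> real ^ 'n) \<Rightarrow> real \<Rightarrow> (nat \<Rightarrow> real ^ 'n) \<Rightarrow> bool"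
  where "projected_gradient_descent X G \<eta> x \<longleftrightarrow>
    x 1 \<in> X \<and> (\<forall>s\<ge>1. x (s + 1) = closest_point X (x s - \<eta> *\<^sub>R G (x s)))"

end

theory Submission
  imports Defs
begin

text \<open>
  Write \<open>p\<close> for the iterate that follows \<open>x\<close>.  The gradient inequality at \<open>x\<close> bounds \<open>f y\<close> from
  below, the quadratic upper bound at \<open>x\<close> bounds \<open>f p\<close> from above, and the obtuse angle at the
  projection \<open>p\<close> converts the linear term \<open>G x \<bullet> (p - y)\<close> into one that involves distances only.
  Together they give, for every \<open>y\<close> in \<open>X\<close>,
  \<open>f p - f y \<le> \<beta> / 2 * (\<parallel>x - y\<parallel>\<^sup>2 - \<parallel>p - y\<parallel>\<^sup>2)\<close>
  (\<open>projected_gradient_step\<close>).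

  This one inequality is used twice.  With \<open>y = x\<close> it shows that the values of \<open>f\<close> decrease along
  the iteration.  With \<open>y\<close> a minimiser the right-hand side telescopes, so the \<open>t - 1\<close> gaps at
  \<open>x 2, \<dots>, x t\<close> sum to at most \<open>\<beta> / 2 * \<parallel>x 1 - y\<parallel>\<^sup>2\<close>; each of them is at least the last gap
  (\<open>projected_gradient_descent_telescoped\<close>).  Adding the bound of the last gap by the first one
  makes \<open>t\<close> copies of the last gap.  This argument yields the constant \<open>1/2\<close> in place of \<open>3\<close>.
\<close>

text \<open>
  Restriction to a segment reduces both inequalities on \<open>f\<close> below to calculus on \<open>{0..1}\<close>.  All
  derivatives stay relative to \<open>X\<close>, so that points on the boundary of \<open>X\<close> need no special
  treatment.
\<close>
lemma gradient_on_segment_derivative: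
  fixes X :: "(real ^ 'n) set"
  assumes "convex X" "gradient_on X f G" "x \<in> X" "y \<in> X" "u \<in> {0..1}"
  shows "((\<lambda>u. f (x + u *\<^sub>R (y - x))) has_real_derivative G (x + u *\<^sub>R (y - x)) \<bullet> (y - x))
           (at u within {0..1})"
proof -
  let ?c = "\<lambda>u. x + u *\<^sub>R (y - x)"
  have cX: "?c v \<in> X" if "v \<in> {0..1}" for v
    using convexD_alt[OF assms(1,3,4), of v] that by (simp add: algebra_simps)
  have df: "(f has_derivative (\<lambda>h. G (?c u) \<bullet> h)) (at (?c u) within ?c ` {0..1})"
    using assms(2) cX[OF assms(5)] cX unfolding gradient_on_def
    by (blast intro: has_derivative_subset)
  have "(?c has_derivative (\<lambda>h. h *\<^sub>R (y - x))) (at u within {0..1})"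
    by (auto intro!: derivative_eq_intros)
  from has_derivative_in_compose[OF this df] show ?thesis
    unfolding has_field_derivative_def by (simp add: mult_commute_abs)
qed

text \<open>
  By convexity every difference quotient of \<open>f\<close> from \<open>x\<close> towards \<open>y\<close> is at most \<open>f y - f x\<close>; the
  directional derivative is their limit.
\<close>
lemma convex_gradient_inequality:
  fixes X :: "(real ^ 'n) set"
  assumes "convex X" "convex_on X f" "gradient_on X f G" "x \<in> X" "y \<in> X"
  shows "f x + G x \<bullet> (y - x) \<le> f y"
proof -
  let ?g = "\<lambda>u. f (x + u *\<^sub>R (y - x))"
  have "(?g has_real_derivative G x \<bullet> (y - x)) (at 0 within {0..1})"
    using gradient_on_segment_derivative[OF assms(1,3,4,5), of 0] by simp
  then have lim: "((\<lambda>u. (?g u - f x) / u) \<longlongrightarrow> G x \<bullet> (y - x)) (at 0 within {0..1})"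
    by (simp add: has_field_derivative_iff)
  have "(?g u - f x) / u \<le> f y - f x" if "0 < u" "u \<le> 1" for u :: real
  proof -
    have "?g u = f ((1 - u) *\<^sub>R x + u *\<^sub>R y)" by (simp add: algebra_simps)
    also have "\<dots> \<le> (1 - u) * f x + u * f y"
      using convex_onD[OF assms(2), of u x y] that assms(4,5) by simp
    finally show ?thesis using that by (simp add: field_simps)
  qed
  then have "eventually (\<lambda>u. (?g u - f x) / u \<le> f y - f x) (at 0 within {0..1})"
    by (auto simp: eventually_at_filter)
  moreover have "at (0::real) within {0..1} \<noteq> bot"
    by (simp add: trivial_limit_within islimpt_Icc)
  ultimately have "G x \<bullet> (y - x) \<le> f y - f x" by (rule tendsto_upperbound[OF lim])
  then show ?thesis by simp
qed

text \<open>
  Along the segment, the slope of \<open>f\<close> at parameter \<open>u\<close> exceeds the initial slope by at most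
  \<open>\<beta> * u * \<parallel>y - x\<parallel>\<^sup>2\<close>, by Cauchy--Schwarz and the Lipschitz bound on \<open>G\<close>.  The mean value theorem,
  applied after the quadratic model has been subtracted, takes the place of integration over \<open>u\<close>.
\<close>
lemma smooth_quadratic_upper_bound:
  fixes X :: "(real ^ 'n) set"
  assumes "convex X" "smooth_on \<beta> X f G" "x \<in> X" "y \<in> X"
  shows "f y \<le> f x + G x \<bullet> (y - x) + \<beta> / 2 * (norm (y - x))\<^sup>2"
proof -
  let ?c = "\<lambda>u. x + u *\<^sub>R (y - x)"
  let ?k = "\<lambda>u. f (?c u) - u * (G x \<bullet> (y - x)) - \<beta> / 2 * u\<^sup>2 * (norm (y - x))\<^sup>2"
  let ?k' = "\<lambda>u. G (?c u) \<bullet> (y - x) - G x \<bullet> (y - x) - \<beta> * u * (norm (y - x))\<^sup>2"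
  have grad: "gradient_on X f G"
    and lip: "\<And>a b. a \<in> X \<Longrightarrow> b \<in> X \<Longrightarrow> norm (G a - G b) \<le> \<beta> * norm (a - b)"
    using assms(2) by (auto simp: smooth_on_def)
  have "(?k has_real_derivative ?k' u) (at u within {0..1})" if "u \<in> {0..1}" for u
    by (rule derivative_eq_intros gradient_on_segment_derivative[OF assms(1) grad assms(3,4) that]
          refl)+ simp
  then have "\<exists>u\<in>{0<..<1}. ?k 1 - ?k 0 = ?k' u * (1 - 0)"
    by (intro mvt_simple) (auto simp: has_field_derivative_def)
  then obtain u where u: "0 < u" "u < 1" and eq: "?k 1 - ?k 0 = ?k' u"
    by auto
  have "?c u \<in> X"
    using convexD_alt[OF assms(1,3,4), of u] u by (simp add: algebra_simps)
  then have "norm (G (?c u) - G x) \<le> \<beta> * (u * norm (y - x))"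
    using lip[of "?c u" x] assms(3) u by simp
  then have "(G (?c u) - G x) \<bullet> (y - x) \<le> \<beta> * (u * norm (y - x)) * norm (y - x)"
    using norm_cauchy_schwarz[of "G (?c u) - G x" "y - x"]
    by (meson mult_right_mono norm_ge_zero order_trans)
  then have "?k' u \<le> 0"
    by (simp add: inner_diff_left power2_eq_square mult.assoc)
  with eq show ?thesis by simp
qed

lemma projected_gradient_step:
  fixes X :: "(real ^ 'n) set"
  assumes "closed X" "convex X" "convex_on X f" "\<beta> > 0" "smooth_on \<beta> X f G"
    and "x \<in> X" "y \<in> X"
  defines "p \<equiv> closest_point X (x - (1 / \<beta>) *\<^sub>R G x)"
  shows "f p - f y \<le> \<beta> / 2 * ((norm (x - y))\<^sup>2 - (norm (p - y))\<^sup>2)"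
proof -
  have pX: "p \<in> X"
    unfolding p_def using assms(1,6) by (intro closest_point_in_set) auto
  have upper: "f p \<le> f x + G x \<bullet> (p - x) + \<beta> / 2 * (norm (p - x))\<^sup>2"
    by (rule smooth_quadratic_upper_bound[OF assms(2,5,6) pX])
  have lower: "f x + G x \<bullet> (y - x) \<le> f y"
    using assms(5) by (intro convex_gradient_inequality[OF assms(2,3) _ assms(6,7)])
      (simp add: smooth_on_def)
  have "(x - (1 / \<beta>) *\<^sub>R G x - p) \<bullet> (y - p) \<le> 0"
    unfolding p_def by (rule closest_point_dot[OF assms(2,1,7)])
  then have "\<beta> * ((x - (1 / \<beta>) *\<^sub>R G x - p) \<bullet> (y - p)) \<le> 0"
    using assms(4) by (simp add: mult_nonneg_nonpos)
  then have angle: "G x \<bullet> (p - y) \<le> \<beta> * ((x - p) \<bullet> (p - y))"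
    using assms(4) by (simp add: inner_diff_left inner_diff_right right_diff_distrib)
  have "f p - f y \<le> \<beta> * ((x - p) \<bullet> (p - y)) + \<beta> / 2 * (norm (p - x))\<^sup>2"
    using upper lower angle by (simp add: inner_diff_right)
  also have "\<dots> = \<beta> / 2 * (2 * ((x - p) \<bullet> (p - y)) + (norm (p - x))\<^sup>2)"
    by (simp add: algebra_simps)
  \<comment> \<open>Expand the square of \<open>x - y = (x - p) + (p - y)\<close>.\<close>
  also have "2 * ((x - p) \<bullet> (p - y)) + (norm (p - x))\<^sup>2 = (norm (x - y))\<^sup>2 - (norm (p - y))\<^sup>2"
    by (simp add: power2_norm_eq_inner inner_diff_left inner_diff_right inner_commute)
  finally show ?thesis .
qed

text \<open>
  The potential \<open>\<beta> / 2 * \<parallel>x s - y\<parallel>\<^sup>2\<close> pays for each new gap, and monotonicity of the values lets the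
  earlier gaps be replaced by the last one.  Here \<open>n\<close> counts the steps made from \<open>x 1\<close>.
\<close>
lemma projected_gradient_descent_telescoped:
  fixes X :: "(real ^ 'n) set"
  assumes "closed X" "convex X" "convex_on X f" "\<beta> > 0" "smooth_on \<beta> X f G"
    and "projected_gradient_descent X G (1 / \<beta>) x" "y \<in> X"
  shows "x (Suc n) \<in> X \<and> f (x (Suc n)) \<le> f (x 1) \<and>
    real n * (f (x (Suc n)) - f y) + \<beta> / 2 * (norm (x (Suc n) - y))\<^sup>2
      \<le> \<beta> / 2 * (norm (x 1 - y))\<^sup>2"
proof (induction n)
  case 0
  then show ?case using assms(6) by (simp add: projected_gradient_descent_def)
next
  case (Suc n)
  let ?a = "x (Suc n)" and ?b = "x (Suc (Suc n))"
  have aX: "?a \<in> X" using Suc by simp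
  have b: "?b = closest_point X (?a - (1 / \<beta>) *\<^sub>R G ?a)"
    using assms(6) by (simp add: projected_gradient_descent_def)
  have bX: "?b \<in> X"
    unfolding b using assms(1) aX by (intro closest_point_in_set) auto
  note step = projected_gradient_step[OF assms(1-5) aX, folded b]
  have "f ?b - f ?a \<le> - (\<beta> / 2 * (norm (?b - ?a))\<^sup>2)" using step[OF aX] by simp
  moreover have "0 \<le> \<beta> / 2 * (norm (?b - ?a))\<^sup>2" using assms(4) by simp
  ultimately have dec: "f ?b \<le> f ?a" by linarith
  then have "real n * (f ?b - f y) \<le> real n * (f ?a - f y)"
    by (intro mult_left_mono) auto
  with step[OF assms(7)] Suc
  have "real (Suc n) * (f ?b - f y) + \<beta> / 2 * (norm (?b - y))\<^sup>2 \<le> \<beta> / 2 * (norm (x 1 - y))\<^sup>2"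
    by (simp add: algebra_simps)
  with bX dec Suc show ?case by auto
qed

theorem theorem3p7:
  fixes X :: "(real ^ 'n) set"
    and f :: "real ^ 'n \<Rightarrow> real"
    and G :: "real ^ 'n \<Rightarrow> real ^ 'n"
    and \<beta> :: real
    and xstar :: "real ^ 'n"
    and x :: "nat \<Rightarrow> real ^ 'n"
    and t :: nat
  assumes "compact X" and "convex X"
    and "convex_on X f"
    and "\<beta> > 0"
    and "smooth_on \<beta> X f G"
    and "is_arg_min f (\<lambda>y. y \<in> X) xstar"
    and "projected_gradient_descent X G (1 / \<beta>) x"
    and "t \<ge> 1"
  shows "f (x t) - f xstar \<le> (3 * \<beta> * (norm (x 1 - xstar))\<^sup>2 + f (x 1) - f xstar) / real t"
proof -
  have "xstar \<in> X" using assms(6) by (simp add: is_arg_min_def)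
  obtain n where t: "t = Suc n" using assms(8) by (cases t) auto
  have dec: "f (x t) \<le> f (x 1)"
    and tel: "real n * (f (x t) - f xstar) + \<beta> / 2 * (norm (x t - xstar))\<^sup>2
      \<le> \<beta> / 2 * (norm (x 1 - xstar))\<^sup>2"
    using projected_gradient_descent_telescoped[OF compact_imp_closed[OF assms(1)]
        assms(2-5,7) \<open>xstar \<in> X\<close>, of n] t by auto
  have "real t * (f (x t) - f xstar) = real n * (f (x t) - f xstar) + (f (x t) - f xstar)"
    by (simp add: t algebra_simps)
  also have "\<dots> \<le> \<beta> / 2 * (norm (x 1 - xstar))\<^sup>2 + (f (x 1) - f xstar)"
  proof -
    have "0 \<le> \<beta> / 2 * (norm (x t - xstar))\<^sup>2" using assms(4) by simp
    with tel dec show ?thesis by linarith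
  qed
  also have "\<dots> \<le> 3 * \<beta> * (norm (x 1 - xstar))\<^sup>2 + f (x 1) - f xstar"
  proof -
    have "0 \<le> \<beta> * (norm (x 1 - xstar))\<^sup>2" using assms(4) by simp
    then show ?thesis by simp
  qed
  finally show ?thesis using assms(8) by (simp add: pos_le_divide_eq mult.commute)
qed

end
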